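(* Let $$B(x,y)=B(x,y;p,q,r)=\sum_{\pi\in\mathcal{F}}x^{|\pi|}y^{\mathrm{trun}(\pi)-1}p^{\#122(\pi)}q^{\#211(\pi)}r^{\#111(\pi)}$$ be the generating function that enumerates the members of $\mathcal{F}$ jointly according to length, $\mathrm{trun}-1$, $\#122$, $\#211$ and $\#111$ (marked by $x$, $y$, $p$, $q$ and $r$, respectively). Then $$B(x,y)=\frac{x(1+(1-r)x)\left(1-(1+r)x-(p-r)x^2\right)^2}{\left(1-(r+y)x-(p-r)x^2y\right)\left(\left(1-(1+r)x-(p-r)x^2\right)^2-x^2(1+(p-r)x)(1+(q-r)x)\right)}.$$
   Context: A Catalan word of length $n\geq 1$ is an integer sequence $\pi=\pi_1\cdots\pi_n$ with $\pi_1=1$ and $1\leq \pi_{i+1}\leq \pi_i+1$ for $1\leq i\leq n-1$. A (weakly) increasing run of a word is a maximal nondecreasing string of consecutive letters. A Catalan word is flattened if the sequence of first letters of its increasing runs, read from left to right, is nondecreasing. $\mathcal{F}_n$ is the set of flattened Catalan words of length $n$, $\mathcal{F}=\cup_{n\geq 1}\mathcal{F}_n$, and $|\pi|$ is the length of $\pi$. For a word $w$, $\mathrm{trun}(w)$ is the number of distinct letters appearing in the rightmost increasing run of $w$. For a pattern $\tau=\tau_1\cdots\tau_m$, $\#\tau(\pi)$ is the number of occurrences of $\tau$ in $\pi$ as a consecutive (subword) pattern, i.e., the number of indices $i$ such that $\pi_i\pi_{i+1}\cdots\pi_{i+m-1}$ is order-isomorphic to $\tau$. Here $x,y,p,q,r$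 are indeterminates and generating functions are formal power series in $x$ with coefficients polynomial in $y,p,q,r$. *)

theory Defs
  imports "HOL-Computational_Algebra.Computational_Algebra"
begin

text \<open>Words are lists, so the letter \<open>\<pi>\<^sub>i\<close> of the mathematical notation is \<open>w ! (i - 1)\<close>.\<close>

definition catalan_word :: "nat list \<Rightarrow> bool" where
  "catalan_word w \<longleftrightarrow> w \<noteq> [] \<and> w ! 0 = 1 \<and>
     (\<forall>i. Suc i < length w \<longrightarrow> 1 \<le> w ! Suc i \<and> w ! Suc i \<le> w ! i + 1)"

text \<open>The weakly increasing runs of a word, from left to right.  The lemmas below show that they are
  the maximal nondecreasing factors.\<close>

fun runs :: "nat list \<Rightarrow> nat list list" where
  "runs [] = []"
| "runs [a] = [[a]]"
| "runs (a # b # w) =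
     (if a \<le> b then (a # hd (runs (b # w))) # tl (runs (b # w)) else [a] # runs (b # w))"

lemma runs_Cons_ex: "\<exists>u us. runs (a # w) = (a # u) # us"
  by (cases w) auto

lemma concat_runs: "concat (runs w) = w"
proof (induction w rule: runs.induct)
  case (3 a b w)
  then show ?case
    using runs_Cons_ex[of b w] by auto
qed auto

lemma runs_nondecreasing: "u \<in> set (runs w) \<Longrightarrow> u \<noteq> [] \<and> sorted u"
proof (induction w arbitrary: u rule: runs.induct)
  case (3 a b w)
  obtain v vs where r: "runs (b # w) = (b # v) # vs"
    using runs_Cons_ex by blast
  show ?case
  proof (cases "a \<le> b")
    case True
    have "sorted (b # v)" "\<And>u. u \<in> set vs \<Longrightarrow> u \<noteq> [] \<and> sorted u"
      using 3(1)[OF True, of "b # v"] 3(1)[OF True] r by (simp_all del: sorted_simps)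
    then show ?thesis
      using 3(4) True r by (fastforce dest: order_trans[of a b])
  next
    case False
    then show ?thesis
      using 3(3)[OF False] 3(4) by auto
  qed
qed auto

lemma runs_maximal: "successively (\<lambda>u v. last u > hd v) (runs w)"
proof (induction w rule: runs.induct)
  case (3 a b w)
  obtain v vs where r: "runs (b # w) = (b # v) # vs"
    using runs_Cons_ex by blast
  show ?case
    using 3 r by (cases vs; cases "a \<le> b") auto
qed auto

definition flattened :: "nat list \<Rightarrow> bool" where
  "flattened w \<longleftrightarrow> sorted (map hd (runs w))"

definition flattened_catalan_words :: "nat \<Rightarrow> nat list set" where
  "flattened_catalan_words n = {w. catalan_word w \<and> flattened w \<and> length w = n}"

definition trun :: "nat list \<Rightarrow> nat" where
  "trun w = card (set (last (runs w)))"

definition order_isomorphic :: "nat list \<Rightarrow> nat list \<Rightarrow> bool" where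
  "order_isomorphic u v \<longleftrightarrow> length u = length v \<and>
     (\<forall>i < length u. \<forall>j < length u. u ! i < u ! j \<longleftrightarrow> v ! i < v ! j)"

definition occurrences :: "nat list \<Rightarrow> nat list \<Rightarrow> nat" where
  "occurrences \<tau> w =
     card {i. i + length \<tau> \<le> length w \<and> order_isomorphic (take (length \<tau>) (drop i w)) \<tau>}"

text \<open>The sum defining a coefficient of the generating function is finite.\<close>

lemma catalan_word_letter_le: "catalan_word w \<Longrightarrow> i < length w \<Longrightarrow> w ! i \<le> Suc i"
proof (induction i)
  case (Suc i)
  then have "w ! Suc i \<le> w ! i + 1" "w ! i \<le> Suc i"
    by (auto simp: catalan_word_def)
  then show ?case by simp
qed (simp add: catalan_word_def)

lemma finite_flattened_catalan_words: "finite (flattened_catalan_words n)"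
proof (rule finite_subset)
  show "flattened_catalan_words n \<subseteq> {w. set w \<subseteq> {..n} \<and> length w = n}"
    using catalan_word_letter_le
    by (fastforce simp: flattened_catalan_words_def in_set_conv_nth)
qed (simp add: finite_lists_length_eq)

text \<open>The polynomial ring over the integers in the four indeterminates \<open>y, p, q, r\<close>, built one
  indeterminate at a time; \<open>y\<close> is the outermost variable and \<open>r\<close> the innermost.\<close>

type_synonym ypqr_poly = "int poly poly poly poly"

definition var_y :: ypqr_poly where "var_y = [:0, 1:]"
definition var_p :: ypqr_poly where "var_p = [:[:0, 1:]:]"
definition var_q :: ypqr_poly where "var_q = [:[:[:0, 1:]:]:]"
definition var_r :: ypqr_poly where "var_r = [:[:[:[:0, 1:]:]:]:]"

text \<open>The generating function, as a power series in \<open>x\<close>: its coefficient of \<open>x\<^sup>n\<close> collects the words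
  of length \<open>n\<close>; there are none for \<open>n = 0\<close>.  Since \<open>trun w \<ge> 1\<close> for a nonempty word \<open>w\<close>, the
  subtraction in the exponent of \<open>y\<close> never truncates.\<close>

definition B_series :: "ypqr_poly fps" where
  "B_series = Abs_fps (\<lambda>n. \<Sum>w \<in> flattened_catalan_words n.
     var_y ^ (trun w - 1) * var_p ^ occurrences [1,2,2] w *
     var_q ^ occurrences [2,1,1] w * var_r ^ occurrences [1,1,1] w)"

text \<open>Division of power series needs coefficients in a field; this is the coefficientwise embedding
  into the power series over the fraction field.\<close>

definition fps_to_fract :: "'a::idom fps \<Rightarrow> 'a fract fps" where
  "fps_to_fract f = Abs_fps (\<lambda>n. to_fract (fps_nth f n))"

end

theory Submission
  imports Defs
begin

text \<open>
  A flattened Catalan word grows by appending letters, and the letters that may follow a word depend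
  only on its last run.  In a Catalan word a weakly increasing run rises by steps of at most one, so
  it uses every letter between its first letter \<open>a\<close> and its last letter \<open>b\<close>, and
  \<open>trun - 1 = b - a\<close>; this number is called the height.  The next letter may be \<open>b + 1\<close> (the height
  increases by one), \<open>b\<close> (the height stays), or any of the \<open>b - a\<close> letters \<open>c\<close> with \<open>a \<le> c < b\<close>:
  the letter \<open>c\<close> starts a new run, which is of height \<open>0\<close>, and being flattened means that \<open>a \<le> c\<close>.

  All three patterns 122, 211 and 111 end in a repeated letter.  Hence only the choice \<open>b\<close> can create
  an occurrence, and whether the pattern is 122, 211 or 111 is decided by the step before: an
  ascent, a descent or a level step.  It therefore suffices to follow two families of series,
  indexed by a function \<open>g\<close> on heights: \<open>T g\<close> (\<open>height_series\<close>), in which the word \<open>w\<close> contributes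
  \<open>g (height w)\<close> times its weight in \<open>p, q, r\<close>, and \<open>P g\<close> (\<open>level_series\<close>), in which that weight is
  replaced by the one that \<open>w\<close> acquires when its last letter is repeated.  With \<open>E = T of_nat\<close>,
  which counts the words together with a descent that may follow, the three choices give linear
  equations (\<open>height_series_eq\<close>, \<open>level_series_eq\<close>) between \<open>T g\<close>, \<open>P g\<close>, \<open>T (g \<circ> Suc)\<close> and
  \<open>E\<close>; eliminating \<open>P g\<close> yields \<open>height_series_functional_equation\<close>.

  Three choices of \<open>g\<close> close the system, since \<open>g \<circ> Suc\<close> is then a combination of the same functions:
  \<open>g k = y\<^sup>k\<close> gives an equation between the wanted series and \<open>E\<close>, while \<open>g k = 1\<close> and \<open>g k = k\<close>
  give two linear equations for \<open>T 1\<close> and \<open>E\<close>.  The series \<open>T 1\<close> and \<open>E\<close> are the value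
  and the derivative in \<open>y\<close> of the wanted series at \<open>y = 1\<close>, and both diagonal entries of their
  system are the kernel at \<open>y = 1\<close>: this is where the squares in the closed form come from.
  Solving for \<open>E\<close> and substituting proves \<open>height_series_power\<close>, an identity without divisions over any
  commutative ring, from which the quotient in the fraction field follows.
\<close>

section \<open>Appending a letter\<close>

lemma runs_eq_Nil_iff [simp]: "runs w = [] \<longleftrightarrow> w = []"
  by (cases w rule: runs.cases) auto

lemma runs_snoc:
  assumes "w \<noteq> []"
  shows "runs (w @ [c]) =
    (if last w \<le> c then butlast (runs w) @ [last (runs w) @ [c]] else runs w @ [[c]])"
  using assms
proof (induction w rule: runs.induct)
  case (3 a b w)
  obtain v vs where r: "runs (b # w) = (b # v) # vs"
    using runs_Cons_ex by blast
  show ?case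
    using 3 r by (cases "a \<le> b"; cases vs) auto
qed auto

definition last_run_head :: "nat list \<Rightarrow> nat" where
  "last_run_head w = hd (last (runs w))"

definition height :: "nat list \<Rightarrow> nat" where
  "height w = last w - last_run_head w"

text \<open>If the new letter continues the last run, the first letter of that run is unchanged;
  otherwise the new letter is a run of its own.\<close>

lemma last_run_head_snoc:
  assumes "w \<noteq> []"
  shows "last_run_head (w @ [c]) = (if last w \<le> c then last_run_head w else c)"
proof -
  have "last (runs w) \<noteq> []"
    using runs_nondecreasing assms by (metis last_in_set runs_eq_Nil_iff)
  then show ?thesis
    using assms by (simp add: last_run_head_def runs_snoc)
qed

lemma last_run_head_singleton [simp]: "last_run_head [a] = a"
  by (simp add: last_run_head_def)

lemma last_run_head_le: "w \<noteq> [] \<Longrightarrow> last_run_head w \<le> last w"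
proof (induction w rule: rev_induct)
  case (snoc c w)
  then show ?case
    by (cases "w = []") (auto simp: last_run_head_snoc)
qed simp

lemma height_snoc:
  assumes "w \<noteq> []"
  shows "height (w @ [c]) = (if last w \<le> c then height w + (c - last w) else 0)"
  using assms last_run_head_le[OF assms] by (simp add: height_def last_run_head_snoc)

lemma catalan_word_snoc:
  assumes "w \<noteq> []"
  shows "catalan_word (w @ [c]) \<longleftrightarrow> catalan_word w \<and> 1 \<le> c \<and> c \<le> last w + 1"
proof -
  let ?step = "\<lambda>w i. 1 \<le> w ! Suc i \<and> w ! Suc i \<le> w ! i + 1"
  obtain m where m: "length w = Suc m"
    using assms by (cases w) auto
  have last: "last w = w ! m"
    using assms m by (simp add: last_conv_nth)
  have "(\<forall>i. Suc i < length (w @ [c]) \<longrightarrow> ?step (w @ [c]) i) \<longleftrightarrow>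
      (\<forall>i<m. ?step (w @ [c]) i) \<and> ?step (w @ [c]) m"
    using m less_Suc_eq by auto
  moreover have "(\<forall>i<m. ?step (w @ [c]) i) \<longleftrightarrow> (\<forall>i. Suc i < length w \<longrightarrow> ?step w i)"
    using m by (auto simp: nth_append)
  moreover have "?step (w @ [c]) m \<longleftrightarrow> 1 \<le> c \<and> c \<le> last w + 1"
    using m last by (simp add: nth_append)
  ultimately show ?thesis
    using assms m by (simp add: catalan_word_def nth_append)
qed

lemma catalan_word_singleton: "catalan_word [a] \<longleftrightarrow> a = 1"
  by (simp add: catalan_word_def)

text \<open>A letter that continues the last run adds no new first letter, and it satisfies the bound
  on the right because the first letter of a run is at most the last one.  A letter below the last
  one starts a new run, and the bound is exactly the condition that it imposes.\<close>

lemma flattened_snoc: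
  assumes "w \<noteq> []"
  shows "flattened (w @ [c]) \<longleftrightarrow> flattened w \<and> last_run_head w \<le> c"
proof -
  obtain us u where r: "runs w = us @ [u]"
    using assms by (metis rev_exhaust runs_eq_Nil_iff)
  have u: "u \<noteq> []"
    using r runs_nondecreasing[of u w] by simp
  have head: "last_run_head w = hd u"
    using r by (simp add: last_run_head_def)
  show ?thesis
    using assms u last_run_head_le[OF assms] unfolding flattened_def
    by (auto simp: runs_snoc r head sorted_append)
qed

lemma catalan_word_last_run_head_pos: "catalan_word w \<Longrightarrow> 1 \<le> last_run_head w"
proof (induction w rule: rev_induct)
  case (snoc c w)
  then show ?case
    by (cases "w = []") (auto simp: last_run_head_snoc catalan_word_snoc catalan_word_singleton)
qed (simp add: catalan_word_def)

text \<open>Within a run the letters rise by at most one at a time, so no value is skipped.\<close>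

lemma set_last_run:
  assumes "catalan_word w"
  shows "set (last (runs w)) = {last_run_head w..last w}"
  using assms
proof (induction w rule: rev_induct)
  case (snoc c w)
  show ?case
  proof (cases "w = []")
    case False
    then have "catalan_word w" "c \<le> last w + 1"
      using snoc.prems by (auto simp: catalan_word_snoc)
    then show ?thesis
      using False snoc.IH last_run_head_le[of w] by (auto simp: runs_snoc last_run_head_snoc)
  qed auto
qed (simp add: catalan_word_def)

lemma trun_eq_Suc_height:
  assumes "catalan_word w"
  shows "trun w = Suc (height w)"
  using last_run_head_le[of w] assms
  by (auto simp: trun_def set_last_run height_def catalan_word_def)

section \<open>Counting subword occurrences\<close>

text \<open>The only window of \<open>w @ [c]\<close> that is not a window of \<open>w\<close> is the last one.\<close>

lemma occurrences_snoc:
  assumes "length \<tau> = Suc m"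
  shows "occurrences \<tau> (w @ [c]) = occurrences \<tau> w +
    (if m \<le> length w \<and> order_isomorphic (drop (length w - m) w @ [c]) \<tau> then 1 else 0)"
proof -
  let ?occ = "\<lambda>w. {i. i + length \<tau> \<le> length w \<and> order_isomorphic (take (length \<tau>) (drop i w)) \<tau>}"
  let ?new = "{i. i = length w - m \<and> m \<le> length w \<and>
    order_isomorphic (drop (length w - m) w @ [c]) \<tau>}"
  have "?occ (w @ [c]) = ?occ w \<union> ?new"
  proof (rule set_eqI)
    fix i
    consider "i + Suc m \<le> length w" | "i + m = length w" | "i + m > length w"
      by linarith
    then show "i \<in> ?occ (w @ [c]) \<longleftrightarrow> i \<in> ?occ w \<union> ?new"
      proof cases
      case 2
      then have "i = length w - m" "m \<le> length w"
        by simp_all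
      then show ?thesis
        using assms by simp
    qed (use assms in auto)
  qed
  moreover have "?occ w \<inter> ?new = {}"
    using assms by auto
  moreover have "finite (?occ w)"
    by (rule finite_subset[of _ "{..length w}"]) auto
  ultimately have "occurrences \<tau> (w @ [c]) = occurrences \<tau> w + card ?new"
    unfolding occurrences_def by (simp add: card_Un_disjoint)
  then show ?thesis
    by simp
qed

lemma occurrences_length_3_snoc:
  assumes "length \<tau> = 3" "w \<noteq> []"
  shows "occurrences \<tau> (w @ [c]) = occurrences \<tau> w +
    (if 2 \<le> length w \<and> order_isomorphic [last (butlast w), last w, c] \<tau> then 1 else 0)"
proof -
  have "drop (length w - 2) w = [last (butlast w), last w]" if len: "2 \<le> length w"
  proof -
    obtain u a b where "w = (u @ [a]) @ [b]"
      using len by (cases w rule: rev_cases; cases "butlast w" rule: rev_cases) auto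
    then show ?thesis
      by (simp only: butlast_snoc last_snoc) simp
  qed
  then show ?thesis
    using occurrences_snoc[of \<tau> 2 w c] assms by auto
qed

lemma order_isomorphic_triple:
  "order_isomorphic [a, b, c] [1, 2, 2] \<longleftrightarrow> a < b \<and> c = b"
  "order_isomorphic [a, b, c] [2, 1, 1] \<longleftrightarrow> b < a \<and> c = b"
  "order_isomorphic [a, b, c] [1, 1, 1] \<longleftrightarrow> a = b \<and> c = b"
  by (auto simp: order_isomorphic_def All_less_Suc numeral_3_eq_3)

definition weight :: "'a::comm_ring_1 \<Rightarrow> 'a \<Rightarrow> 'a \<Rightarrow> nat list \<Rightarrow> 'a" where
  "weight p q r w =
     p ^ occurrences [1,2,2] w * q ^ occurrences [2,1,1] w * r ^ occurrences [1,1,1] w"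

text \<open>The factor by which the weight of a word changes when its last letter is repeated: the step
  before the repetition decides which of the patterns 122, 111 and 211 is completed, and a word of
  length one is too short to complete any.\<close>

definition level_factor :: "'a::comm_ring_1 \<Rightarrow> 'a \<Rightarrow> 'a \<Rightarrow> nat list \<Rightarrow> 'a" where
  "level_factor p q r w =
     (if length w < 2 then 1
      else if last (butlast w) < last w then p
      else if last (butlast w) = last w then r else q)"

lemma weight_snoc:
  assumes "w \<noteq> []"
  shows "weight p q r (w @ [c]) =
    weight p q r w * (if c = last w then level_factor p q r w else 1)"
  using assms
  by (auto simp: weight_def level_factor_def occurrences_length_3_snoc order_isomorphic_triple
      power_add ac_simps simp del: One_nat_def)

lemma level_factor_snoc:
  assumes "w \<noteq> []"
  shows "level_factor p q r (w @ [c]) =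
    (if last w < c then p else if last w = c then r else q)"
  using assms by (cases w) (auto simp: level_factor_def)

lemma level_factor_singleton: "level_factor p q r [a] = 1"
  by (simp add: level_factor_def)

lemma weight_singleton: "weight p q r [a] = 1"
  by (simp add: weight_def occurrences_def)

section \<open>The recurrence on the length\<close>

lemma flattened_catalan_words_0: "flattened_catalan_words 0 = {}"
  by (auto simp: flattened_catalan_words_def catalan_word_def)

lemma flattened_catalan_words_1: "flattened_catalan_words (Suc 0) = {[1]}"
  by (auto simp: flattened_catalan_words_def catalan_word_def flattened_def length_Suc_conv)

text \<open>The upper bound on the new letter is the Catalan condition and the lower bound the flattened
  condition; the latter implies that the letter is positive.  The empty word, which cannot be
  extended in this way, is the reason for \<open>n > 0\<close>.\<close>

lemma flattened_catalan_words_Suc: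
  assumes "n > 0"
  shows "flattened_catalan_words (Suc n) =
    (\<lambda>(w, c). w @ [c]) ` (SIGMA w:flattened_catalan_words n. {last_run_head w..last w + 1})"
    (is "?L = ?R")
proof (rule set_eqI)
  fix v
  show "v \<in> ?L \<longleftrightarrow> v \<in> ?R"
  proof (cases v rule: rev_cases)
    case (snoc w c)
    have "v \<in> ?L \<longleftrightarrow> w \<in> flattened_catalan_words n \<and> last_run_head w \<le> c \<and> c \<le> last w + 1"
      using assms snoc catalan_word_last_run_head_pos[of w]
      by (cases "w = []") (auto simp: flattened_catalan_words_def catalan_word_snoc flattened_snoc)
    then show ?thesis
      using snoc by auto
  qed (auto simp: flattened_catalan_words_def)
qed

text \<open>The three summands are the words that end in an ascent, in a level step and in a descent.\<close>

lemma sum_flattened_catalan_words_Suc: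
  fixes h :: "nat list \<Rightarrow> 'a::comm_ring_1"
  assumes "n > 0"
  shows "(\<Sum>v\<in>flattened_catalan_words (Suc n). h v) =
    (\<Sum>w\<in>flattened_catalan_words n. h (w @ [last w + 1]) + h (w @ [last w])
       + (\<Sum>c\<in>{last_run_head w..<last w}. h (w @ [c])))"
proof -
  have "inj_on (\<lambda>(w, c). w @ [c]) A" for A :: "(nat list \<times> nat) set"
    by (auto simp: inj_on_def)
  then have "(\<Sum>v\<in>flattened_catalan_words (Suc n). h v) =
      (\<Sum>(w, c)\<in>(SIGMA w:flattened_catalan_words n. {last_run_head w..last w + 1}). h (w @ [c]))"
    by (simp add: flattened_catalan_words_Suc[OF assms] sum.reindex case_prod_unfold)
  also have "\<dots> = (\<Sum>w\<in>flattened_catalan_words n. \<Sum>c\<in>{last_run_head w..last w + 1}. h (w @ [c]))"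
    by (rule sum.Sigma[symmetric]) (auto simp: finite_flattened_catalan_words)
  also have "\<dots> = (\<Sum>w\<in>flattened_catalan_words n. h (w @ [last w + 1]) + h (w @ [last w])
       + (\<Sum>c\<in>{last_run_head w..<last w}. h (w @ [c])))"
  proof (rule sum.cong)
    fix w assume "w \<in> flattened_catalan_words n"
    then have "last_run_head w \<le> last w"
      by (intro last_run_head_le) (auto simp: flattened_catalan_words_def catalan_word_def)
    then have "{last_run_head w..last w + 1} =
        insert (last w + 1) (insert (last w) {last_run_head w..<last w})"
      by auto
    then show "(\<Sum>c\<in>{last_run_head w..last w + 1}. h (w @ [c])) =
        h (w @ [last w + 1]) + h (w @ [last w]) + (\<Sum>c\<in>{last_run_head w..<last w}. h (w @ [c]))"
      by (simp add: add.assoc)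
  qed simp
  finally show ?thesis .
qed

section \<open>The functional equations\<close>

text \<open>Leaving the dependence on the height to an arbitrary function \<open>g\<close> keeps the equations linear:
  evaluating at \<open>y\<close>, at \<open>1\<close>, or differentiating in \<open>y\<close> at \<open>1\<close> are all choices of \<open>g\<close>.\<close>

definition height_series :: "'a::comm_ring_1 \<Rightarrow> 'a \<Rightarrow> 'a \<Rightarrow> (nat \<Rightarrow> 'a) \<Rightarrow> 'a fps" where
  "height_series p q r g =
     Abs_fps (\<lambda>n. \<Sum>w\<in>flattened_catalan_words n. g (height w) * weight p q r w)"

text \<open>Up to a shift in length, this series enumerates the words that end in a level step.\<close>

definition level_series :: "'a::comm_ring_1 \<Rightarrow> 'a \<Rightarrow> 'a \<Rightarrow> (nat \<Rightarrow> 'a) \<Rightarrow> 'a fps" where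
  "level_series p q r g =
     Abs_fps (\<lambda>n. \<Sum>w\<in>flattened_catalan_words n.
       g (height w) * weight p q r w * level_factor p q r w)"

lemma fps_eq_X_mult_shift:
  fixes f h :: "'a::comm_ring_1 fps"
  assumes "fps_nth f 0 = 0" "\<And>n. fps_nth f (Suc n) = fps_nth h n"
  shows "f = fps_X * h"
proof (rule fps_ext)
  fix n
  show "fps_nth f n = fps_nth (fps_X * h) n"
    using assms by (cases n) (simp_all del: fps_mult_fps_X_commute)
qed

lemma flattened_catalan_wordsD:
  assumes "w \<in> flattened_catalan_words n"
  shows "w \<noteq> []" "last_run_head w \<le> last w"
  using assms last_run_head_le[of w]
  by (auto simp: flattened_catalan_words_def catalan_word_def)

text \<open>The summands are the word of length one and the words obtained by an ascent, by a level step
  and by a descent.  A descent leads to height \<open>0\<close> and can be chosen in \<open>height w\<close> ways, which is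
  why it contributes \<open>g 0\<close> times the series weighted by the height.\<close>

lemma height_series_eq:
  "height_series p q r g = fps_X * (fps_const (g 0) + height_series p q r (\<lambda>k. g (Suc k))
     + level_series p q r g + fps_const (g 0) * height_series p q r of_nat)"
proof (rule fps_eq_X_mult_shift)
  show "fps_nth (height_series p q r g) (Suc n) =
      fps_nth (fps_const (g 0) + height_series p q r (\<lambda>k. g (Suc k))
        + level_series p q r g + fps_const (g 0) * height_series p q r of_nat) n" for n
  proof (cases "n = 0")
    case True
    then show ?thesis
      by (simp add: height_series_def level_series_def flattened_catalan_words_0
          flattened_catalan_words_1 weight_singleton height_def)
  next
    case False
    have "fps_nth (height_series p q r g) (Suc n) =
        (\<Sum>w\<in>flattened_catalan_words n. g (Suc (height w)) * weight p q r w
          + g (height w) * weight p q r w * level_factor p q r w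
          + g 0 * (of_nat (height w) * weight p q r w))"
      unfolding height_series_def fps_nth_Abs_fps
    proof (subst sum_flattened_catalan_words_Suc, use False in simp, rule sum.cong)
      fix w assume "w \<in> flattened_catalan_words n"
      note w = flattened_catalan_wordsD[OF this]
      have "(\<Sum>c\<in>{last_run_head w..<last w}. g (height (w @ [c])) * weight p q r (w @ [c])) =
          of_nat (height w) * (g 0 * weight p q r w)"
        using w by (simp add: height_snoc weight_snoc) (simp add: height_def)
      then show "g (height (w @ [last w + 1])) * weight p q r (w @ [last w + 1])
          + g (height (w @ [last w])) * weight p q r (w @ [last w])
          + (\<Sum>c\<in>{last_run_head w..<last w}. g (height (w @ [c])) * weight p q r (w @ [c])) =
        g (Suc (height w)) * weight p q r w
          + g (height w) * weight p q r w * level_factor p q r w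
          + g 0 * (of_nat (height w) * weight p q r w)"
        using w by (simp add: height_snoc weight_snoc ac_simps)
    qed simp
    then show ?thesis
      using False by (simp add: height_series_def level_series_def sum.distrib sum_distrib_left)
  qed
qed (simp add: height_series_def flattened_catalan_words_0)

text \<open>The words are classified by their last step as before; a further level step then
  completes an occurrence of 122 after an ascent, of 111 after a level step and of 211 after a
  descent, which inserts the factors \<open>p\<close>, \<open>r\<close> and \<open>q\<close>.\<close>

lemma level_series_eq:
  "level_series p q r g = fps_X * (fps_const (g 0) + fps_const p * height_series p q r (\<lambda>k. g (Suc k))
     + fps_const r * level_series p q r g + fps_const q * (fps_const (g 0) * height_series p q r of_nat))"
proof (rule fps_eq_X_mult_shift)
  show "fps_nth (level_series p q r g) (Suc n) =
      fps_nth (fps_const (g 0) + fps_const p * height_series p q r (\<lambda>k. g (Suc k))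
        + fps_const r * level_series p q r g
        + fps_const q * (fps_const (g 0) * height_series p q r of_nat)) n" for n
  proof (cases "n = 0")
    case True
    then show ?thesis
      by (simp add: height_series_def level_series_def flattened_catalan_words_0
          flattened_catalan_words_1 weight_singleton level_factor_singleton height_def)
  next
    case False
    have "fps_nth (level_series p q r g) (Suc n) =
        (\<Sum>w\<in>flattened_catalan_words n. p * (g (Suc (height w)) * weight p q r w)
          + r * (g (height w) * weight p q r w * level_factor p q r w)
          + q * (g 0 * (of_nat (height w) * weight p q r w)))"
      unfolding level_series_def fps_nth_Abs_fps
    proof (subst sum_flattened_catalan_words_Suc, use False in simp, rule sum.cong)
      fix w assume "w \<in> flattened_catalan_words n"
      note w = flattened_catalan_wordsD[OF this]
      have "(\<Sum>c\<in>{last_run_head w..<last w}. g (height (w @ [c])) * weight p q r (w @ [c])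
            * level_factor p q r (w @ [c])) = of_nat (height w) * (g 0 * weight p q r w * q)"
        using w by (simp add: height_snoc weight_snoc level_factor_snoc) (simp add: height_def)
      then show "g (height (w @ [last w + 1])) * weight p q r (w @ [last w + 1])
            * level_factor p q r (w @ [last w + 1])
          + g (height (w @ [last w])) * weight p q r (w @ [last w])
            * level_factor p q r (w @ [last w])
          + (\<Sum>c\<in>{last_run_head w..<last w}. g (height (w @ [c])) * weight p q r (w @ [c])
            * level_factor p q r (w @ [c])) =
        p * (g (Suc (height w)) * weight p q r w)
          + r * (g (height w) * weight p q r w * level_factor p q r w)
          + q * (g 0 * (of_nat (height w) * weight p q r w))"
        using w by (simp add: height_snoc weight_snoc level_factor_snoc ac_simps)
    qed simp
    then show ?thesis
      using False by (simp add: height_series_def level_series_def sum.distrib sum_distrib_left)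
  qed
qed (simp add: level_series_def flattened_catalan_words_0)

text \<open>The equation for \<open>level_series\<close> expresses \<open>1 - R * x\<close> times that series through
  the others, so it can be eliminated from the equation for \<open>height_series\<close> after multiplying by \<open>1 - R * x\<close>.\<close>

lemma height_series_functional_equation:
  fixes p q r :: "'a::comm_ring_1" and g :: "nat \<Rightarrow> 'a"
  defines "x \<equiv> fps_X" and "P \<equiv> fps_const p" and "Q \<equiv> fps_const q" and "R \<equiv> fps_const r"
    and "G \<equiv> fps_const (g 0)" and "E \<equiv> height_series p q r of_nat"
  shows "(1 - R * x) * height_series p q r g =
    x * (1 + (P - R) * x) * height_series p q r (\<lambda>k. g (Suc k))
    + G * x * (1 + (1 - R) * x) + G * x * (1 + (Q - R) * x) * E"
proof -
  define T U L where "T = height_series p q r g" and "U = height_series p q r (\<lambda>k. g (Suc k))"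
    and "L = level_series p q r g"
  have T: "T = x * (G + U + L + G * E)" and L: "L = x * (G + P * U + R * L + Q * (G * E))"
    using height_series_eq[of p q r g] level_series_eq[of p q r g]
    by (simp_all add: T_def U_def L_def assms)
  have "(1 - R * x) * L = L - R * x * L"
    by (simp add: algebra_simps)
  also have "\<dots> = x * (G + P * U + R * L + Q * (G * E)) - R * x * L"
    using L by (rule arg_cong)
  also have "\<dots> = x * (G + P * U + Q * (G * E))"
    by (simp add: algebra_simps)
  finally have L': "(1 - R * x) * L = x * (G + P * U + Q * (G * E))" .
  have "(1 - R * x) * T = (1 - R * x) * (x * (G + U + L + G * E))"
    by (simp only: T)
  also have "\<dots> = (1 - R * x) * x * (G + U + G * E) + x * ((1 - R * x) * L)"
    by (simp add: algebra_simps)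
  also have "\<dots> = x * (1 + (P - R) * x) * U
      + G * x * (1 + (1 - R) * x) + G * x * (1 + (Q - R) * x) * E"
    unfolding L' by (simp add: algebra_simps)
  finally show ?thesis
    by (simp add: T_def U_def)
qed

lemma height_series_cmult: "height_series p q r (\<lambda>k. a * g k) = fps_const a * height_series p q r g"
  by (simp add: height_series_def fps_eq_iff sum_distrib_left mult.assoc)

lemma height_series_add:
  "height_series p q r (\<lambda>k. f k + g k) = height_series p q r f + height_series p q r g"
  by (simp add: height_series_def fps_eq_iff sum.distrib distrib_right)

text \<open>Below, \<open>K\<close> is the kernel that multiplies the wanted series \<open>B\<close>, and \<open>M\<close> is its value at
  \<open>y = 1\<close>.  The equations for \<open>A\<close> and \<open>E\<close> form a linear system with determinant \<open>N\<close>.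
  Everything is multiplied out, so no series has to be inverted.\<close>

theorem height_series_power:
  fixes p q r y :: "'a::comm_ring_1"
  defines "x \<equiv> fps_X" and "P \<equiv> fps_const p" and "Q \<equiv> fps_const q" and "R \<equiv> fps_const r"
    and "Y \<equiv> fps_const y"
  shows "height_series p q r (\<lambda>k. y ^ k) *
      ((1 - (R + Y) * x - (P - R) * x^2 * Y) *
       ((1 - (1 + R) * x - (P - R) * x^2)^2 - x^2 * (1 + (P - R) * x) * (1 + (Q - R) * x))) =
    x * (1 + (1 - R) * x) * (1 - (1 + R) * x - (P - R) * x^2)^2"
proof -
  define B A E where "B = height_series p q r (\<lambda>k. y ^ k)" and "A = height_series p q r (\<lambda>_. 1)"
    and "E = height_series p q r of_nat"
  note feq = height_series_functional_equation[of r p q, folded x_def P_def Q_def R_def, folded E_def]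
  have B: "(1 - R * x) * B =
      x * (1 + (P - R) * x) * (Y * B) + x * (1 + (1 - R) * x) + x * (1 + (Q - R) * x) * E"
    using feq[of "\<lambda>k. y ^ k"] by (simp add: B_def Y_def height_series_cmult)
  have A: "(1 - R * x) * A =
      x * (1 + (P - R) * x) * A + x * (1 + (1 - R) * x) + x * (1 + (Q - R) * x) * E"
    using feq[of "\<lambda>_. 1"] by (simp add: A_def)
  \<comment> \<open>An ascent turns the weight \<open>k\<close> into \<open>k + 1\<close>, which couples \<open>E\<close> to \<open>A\<close>; the terms with
    \<open>g 0\<close> vanish.\<close>
  have "height_series p q r (\<lambda>k. of_nat (Suc k)) = A + E"
    by (simp add: A_def E_def height_series_add)
  then have E: "(1 - R * x) * E = x * (1 + (P - R) * x) * (A + E)"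
    using feq[of of_nat] by (simp add: E_def)
  define K M N where "K = 1 - (R + Y) * x - (P - R) * x^2 * Y"
    and "M = 1 - (1 + R) * x - (P - R) * x^2"
    and "N = M^2 - x^2 * (1 + (P - R) * x) * (1 + (Q - R) * x)"
  have "B * K = (1 - R * x) * B - x * (1 + (P - R) * x) * (Y * B)"
    unfolding K_def by (simp add: algebra_simps power2_eq_square)
  then have BK: "B * K = x * (1 + (1 - R) * x) + x * (1 + (Q - R) * x) * E"
    by (simp add: B)
  have "A * M = (1 - R * x) * A - x * (1 + (P - R) * x) * A"
    unfolding M_def by (simp add: algebra_simps power2_eq_square)
  then have AM: "A * M = x * (1 + (1 - R) * x) + x * (1 + (Q - R) * x) * E"
    by (simp add: A)
  have "E * M = (1 - R * x) * E - x * (1 + (P - R) * x) * E"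
    unfolding M_def by (simp add: algebra_simps power2_eq_square)
  then have EM: "E * M = x * (1 + (P - R) * x) * A"
    unfolding E by (simp add: distrib_left)
  have "E * N = (E * M) * M - x^2 * (1 + (P - R) * x) * (1 + (Q - R) * x) * E"
    unfolding N_def by (simp add: right_diff_distrib power2_eq_square[of M] mult_ac)
  also have "\<dots> = x * (1 + (P - R) * x) * (A * M)
      - x^2 * (1 + (P - R) * x) * (1 + (Q - R) * x) * E"
    by (simp only: EM mult.assoc)
  also have "\<dots> = x^2 * (1 + (P - R) * x) * (1 + (1 - R) * x)"
    unfolding AM by (simp add: algebra_simps power2_eq_square)
  finally have EN: "E * N = x^2 * (1 + (P - R) * x) * (1 + (1 - R) * x)" .
  have "B * (K * N) = x * (1 + (1 - R) * x) * N + x * (1 + (Q - R) * x) * (E * N)"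
    unfolding mult.assoc[of B K N, symmetric] BK by (simp only: distrib_right mult.assoc)
  also have "\<dots> = x * (1 + (1 - R) * x) * M^2"
    unfolding EN unfolding N_def by (simp add: algebra_simps power2_eq_square)
  finally show ?thesis
    unfolding B_def K_def N_def M_def .
qed

section \<open>The closed form\<close>

text \<open>The embedding into the fraction field is a ring homomorphism, so it can be moved onto the
  indeterminates.\<close>

lemma fps_to_fract_B_series:
  "fps_to_fract B_series =
    height_series (to_fract var_p) (to_fract var_q) (to_fract var_r) (\<lambda>k. to_fract var_y ^ k)"
proof (rule fps_ext)
  fix n
  have "to_fract (\<Sum>w\<in>S. f w) = (\<Sum>w\<in>S. to_fract (f w))"
    for S :: "nat list set" and f :: "nat list \<Rightarrow> ypqr_poly"
    by (induction S rule: infinite_finite_induct) simp_all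
  moreover have "to_fract (a ^ k) = to_fract a ^ k" for a :: ypqr_poly and k
    by (induction k) simp_all
  ultimately show "fps_nth (fps_to_fract B_series) n =
      fps_nth (height_series (to_fract var_p) (to_fract var_q) (to_fract var_r)
        (\<lambda>k. to_fract var_y ^ k)) n"
    unfolding fps_to_fract_def B_series_def height_series_def fps_nth_Abs_fps
    by (auto intro!: sum.cong simp: weight_def flattened_catalan_words_def trun_eq_Suc_height
        mult.assoc simp del: One_nat_def)
qed

text \<open>The denominator has constant coefficient \<open>1\<close>, so it is nonzero and the identity can be
  divided by it.\<close>

theorem theorem2p2:
  shows "let x = fps_X;
             y = fps_const (to_fract var_y);
             p = fps_const (to_fract var_p);
             q = fps_const (to_fract var_q);
             r = fps_const (to_fract var_r)
         in fps_to_fract B_series =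
              (x * (1 + (1 - r) * x) * (1 - (1 + r) * x - (p - r) * x^2)^2) /
              ((1 - (r + y) * x - (p - r) * x^2 * y) *
               ((1 - (1 + r) * x - (p - r) * x^2)^2
                 - x^2 * (1 + (p - r) * x) * (1 + (q - r) * x)))"
proof -
  define x y p q r where "x = (fps_X :: ypqr_poly fract fps)"
    and "y = fps_const (to_fract var_y)" and "p = fps_const (to_fract var_p)"
    and "q = fps_const (to_fract var_q)" and "r = fps_const (to_fract var_r)"
  let ?N = "x * (1 + (1 - r) * x) * (1 - (1 + r) * x - (p - r) * x^2)^2"
  let ?D = "(1 - (r + y) * x - (p - r) * x^2 * y) *
    ((1 - (1 + r) * x - (p - r) * x^2)^2 - x^2 * (1 + (p - r) * x) * (1 + (q - r) * x))"
  have "fps_nth ?D 0 = 1"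
    by (simp add: x_def fps_mult_nth_0 fps_power_zeroth)
  then have "?D \<noteq> 0"
    by (metis fps_zero_nth zero_neq_one)
  moreover have "fps_to_fract B_series * ?D = ?N"
    unfolding fps_to_fract_B_series x_def y_def p_def q_def r_def by (rule height_series_power)
  ultimately have "fps_to_fract B_series = ?N / ?D"
    by (metis nonzero_mult_div_cancel_right)
  then show ?thesis
    by (simp only: Let_def x_def y_def p_def q_def r_def)
qed

end
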